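(* Let $\alpha,\beta\ge 0$ be real numbers with $\alpha+\beta>0$, let $a<b$ be real numbers, and let $f,g:\mathbb{R}\to\mathbb{R}$ be $\alpha,\beta$-symmetric integrable on $[a,b]$. Let $c\in[a,b]$ and $k\in\mathbb{R}$. Then: 1. $\int_a^a f(t)\,d_{\alpha,\beta}t=0$; 2. $\int_a^b f(t)\,d_{\alpha,\beta}t=\int_a^c f(t)\,d_{\alpha,\beta}t+\int_c^b f(t)\,d_{\alpha,\beta}t$, when the integrals exist; 3. $\int_a^b f(t)\,d_{\alpha,\beta}t=-\int_b^a f(t)\,d_{\alpha,\beta}t$; 4. $kf$ is $\alpha,\beta$-symmetric integrable on $[a,b]$ and $\int_a^b kf(t)\,d_{\alpha,\beta}t=k\int_a^b f(t)\,d_{\alpha,\beta}t$; 5. $f+g$ is $\alpha,\beta$-symmetric integrable on $[a,b]$ and $\int_a^b (f+g)(t)\,d_{\alpha,\beta}t=\int_a^b f(t)\,d_{\alpha,\beta}t+\int_a^b g(t)\,d_{\alpha,\beta}t$; 6. $fg$ is $\alpha,\beta$-symmetric integrable on $[a,b]$ provided $g$ is a nonnegative function.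
   Context: Let $h:\mathbb{R}\to\mathbb{R}$ and let $u,v$ be reals (the defining formulas below are applied for limits of integration in any order, including $u=v$ and $u>v$). For $\alpha>0$, $h$ is $\alpha$-forward integrable between $u$ and $v$ (on $[u,v]$ if $u<v$) if the series $\int_x^{+\infty}h(t)\Delta_\alpha t:=\alpha\sum_{k=0}^{+\infty}h(x+k\alpha)$ converges for $x=u$ and $x=v$; then $\int_u^v h(t)\Delta_\alpha t:=\int_u^{+\infty}h(t)\Delta_\alpha t-\int_v^{+\infty}h(t)\Delta_\alpha t$. For $\beta>0$, $h$ is $\beta$-backward integrable between $u$ and $v$ (on $[u,v]$ if $u<v$) if the series $\int_{-\infty}^x h(t)\nabla_\beta t:=\beta\sum_{k=0}^{+\infty}h(x-k\beta)$ converges for $x=u$ and $x=v$; then $\int_u^v h(t)\nabla_\beta t:=\int_{-\infty}^v h(t)\nabla_\beta t-\int_{-\infty}^u h(t)\nabla_\beta t$. For $\alpha,\beta\ge 0$ with $\alpha+\beta>0$, $h$ is $\alpha,\beta$-symmetric integrable (on $[u,v]$ if $u<v$), and the integral from $u$ to $v$ exists, if $h$ is $\alpha$-forward and $\beta$-backward integrable between $u$ and $v$ (the forward requirement is dropped if $\alpha=0$, and the backward requirement is dropped if $\beta=0$); then $$\int_u^v h(t)\,d_{\alpha,\beta}t:=\frac{\alpha}{\alpha+\beta}\int_u^v h(t)\Delta_\alpha t+\frac{\beta}{\alpha+\beta}\int_u^v h(t)\nabla_\beta t,$$ where a term with zero coefficient is omitted. *)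

theory Defs
  imports Complex_Main
begin

definition forward_tail :: "real \<Rightarrow> (real \<Rightarrow> real) \<Rightarrow> real \<Rightarrow> real" where
  "forward_tail \<alpha> h x = \<alpha> * (\<Sum>k. h (x + real k * \<alpha>))"

definition forward_integrable :: "real \<Rightarrow> (real \<Rightarrow> real) \<Rightarrow> real \<Rightarrow> real \<Rightarrow> bool" where
  "forward_integrable \<alpha> h u v \<longleftrightarrow>
     summable (\<lambda>k. h (u + real k * \<alpha>)) \<and> summable (\<lambda>k. h (v + real k * \<alpha>))"

definition forward_integral :: "real \<Rightarrow> (real \<Rightarrow> real) \<Rightarrow> real \<Rightarrow> real \<Rightarrow> real" where
  "forward_integral \<alpha> h u v = forward_tail \<alpha> h u - forward_tail \<alpha> h v"

definition backward_tail :: "real \<Rightarrow> (real \<Rightarrow> real) \<Rightarrow> real \<Rightarrow> real" where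
  "backward_tail \<beta> h x = \<beta> * (\<Sum>k. h (x - real k * \<beta>))"

definition backward_integrable :: "real \<Rightarrow> (real \<Rightarrow> real) \<Rightarrow> real \<Rightarrow> real \<Rightarrow> bool" where
  "backward_integrable \<beta> h u v \<longleftrightarrow>
     summable (\<lambda>k. h (u - real k * \<beta>)) \<and> summable (\<lambda>k. h (v - real k * \<beta>))"

definition backward_integral :: "real \<Rightarrow> (real \<Rightarrow> real) \<Rightarrow> real \<Rightarrow> real \<Rightarrow> real" where
  "backward_integral \<beta> h u v = backward_tail \<beta> h v - backward_tail \<beta> h u"

text \<open>
  The forward and backward notions are only meaningful for a positive step. Below, a zero
  step imposes no summability requirement, and the corresponding summand of the integral
  vanishes because its coefficient is zero, whatever value \<open>suminf\<close> returns.
  The limits \<open>u\<close> and \<open>v\<close> may come in any order.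
\<close>

definition symmetric_integrable ::
  "real \<Rightarrow> real \<Rightarrow> (real \<Rightarrow> real) \<Rightarrow> real \<Rightarrow> real \<Rightarrow> bool" where
  "symmetric_integrable \<alpha> \<beta> h u v \<longleftrightarrow>
     (\<alpha> \<noteq> 0 \<longrightarrow> forward_integrable \<alpha> h u v) \<and> (\<beta> \<noteq> 0 \<longrightarrow> backward_integrable \<beta> h u v)"

definition symmetric_integral ::
  "real \<Rightarrow> real \<Rightarrow> (real \<Rightarrow> real) \<Rightarrow> real \<Rightarrow> real \<Rightarrow> real" where
  "symmetric_integral \<alpha> \<beta> h u v =
     \<alpha> / (\<alpha> + \<beta>) * forward_integral \<alpha> h u v + \<beta> / (\<alpha> + \<beta>) * backward_integral \<beta> h u v"

end

theory Submission
  imports Defs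
begin

text \<open>
  The two one-sided notions are really one: \<open>x - k\<beta> = x + k(-\<beta>)\<close>, so the backward integral with
  step \<open>\<beta>\<close> is the forward integral with step \<open>-\<beta>\<close>. The orientation flips twice,
  once in the sign of the prefactor and once in the order in which the tails are subtracted.
  Linearity and integrability of products are therefore established once, for forward integrals
  whose step may have any sign, and are then used for the steps \<open>\<alpha>\<close> and \<open>-\<beta>\<close>.

  Parts 1 to 3 hold because the integral is a difference of tails, so it telescopes. Parts 4 and 5
  are linearity of convergent series. A zero step does no harm: it multiplies its tails by zero,
  which makes the integral vanish even though no series is then assumed to converge.

  Part 6 combines the convergence of two series. The terms of the series of \<open>f\<close> tend to zero,
  hence are bounded, say by \<open>C\<close>; since \<open>g\<close> is nonnegative, its series converges absolutely, and
  \<open>C g\<close> dominates \<open>|f g|\<close>.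
\<close>

lemma backward_integrable_eq_forward:
  "backward_integrable \<beta> h u v \<longleftrightarrow> forward_integrable (- \<beta>) h u v"
  by (simp add: backward_integrable_def forward_integrable_def)

lemma backward_integral_eq_forward:
  "backward_integral \<beta> h u v = forward_integral (- \<beta>) h u v"
  by (simp add: backward_integral_def forward_integral_def backward_tail_def forward_tail_def)

text \<open>
  The condition on the backward step reads \<open>- \<beta> \<noteq> 0\<close> so that both conjuncts are instances of
  \<open>s \<noteq> 0 \<longrightarrow> forward_integrable s h u v\<close>, the form in which the linearity lemmas take it.
\<close>

lemma symmetric_integrable_eq_forward:
  "symmetric_integrable \<alpha> \<beta> h u v \<longleftrightarrow>
     (\<alpha> \<noteq> 0 \<longrightarrow> forward_integrable \<alpha> h u v) \<and> (- \<beta> \<noteq> 0 \<longrightarrow> forward_integrable (- \<beta>) h u v)"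
  by (simp add: symmetric_integrable_def backward_integrable_eq_forward)

lemma symmetric_integral_eq_forward:
  "symmetric_integral \<alpha> \<beta> h u v =
     \<alpha> / (\<alpha> + \<beta>) * forward_integral \<alpha> h u v + \<beta> / (\<alpha> + \<beta>) * forward_integral (- \<beta>) h u v"
  by (simp add: symmetric_integral_def backward_integral_eq_forward)

text \<open>
  Linearity rests on the convergence of the series, since \<open>suminf\<close> of a divergent series is
  unspecified; for step zero the prefactor of the tails replaces that convergence.
\<close>

lemma forward_integral_cmult:
  assumes "s \<noteq> 0 \<longrightarrow> forward_integrable s h u v"
  shows "forward_integral s (\<lambda>t. k * h t) u v = k * forward_integral s h u v"
proof (cases "s = 0")
  case False
  with assms show ?thesis
    by (simp add: forward_integrable_def forward_integral_def forward_tail_def suminf_mult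
        algebra_simps)
qed (simp add: forward_integral_def forward_tail_def)

lemma forward_integral_add:
  assumes "s \<noteq> 0 \<longrightarrow> forward_integrable s f u v" and "s \<noteq> 0 \<longrightarrow> forward_integrable s g u v"
  shows "forward_integral s (\<lambda>t. f t + g t) u v = forward_integral s f u v + forward_integral s g u v"
proof (cases "s = 0")
  case False
  with assms show ?thesis
    by (simp add: forward_integrable_def forward_integral_def forward_tail_def
        suminf_add[symmetric] algebra_simps)
qed (simp add: forward_integral_def forward_tail_def)

text \<open>
  The product of two convergent series taken term by term may diverge: both factors can be
  \<open>(-1)^n / sqrt (n + 1)\<close>. Nonnegativity of one factor excludes this, because it makes that series
  absolutely convergent, and multiplying by the bounded terms of the other series preserves
  absolute convergence.
\<close>

lemma summable_mult_nonneg: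
  fixes F G :: "nat \<Rightarrow> real"
  assumes "summable F" and "summable G" and nonneg: "\<And>n. 0 \<le> G n"
  shows "summable (\<lambda>n. F n * G n)"
proof -
  obtain C where C: "\<And>n. norm (F n) \<le> C"
    using summable_imp_Bseq[OF \<open>summable F\<close>] by (auto simp: Bseq_def)
  show ?thesis
  proof (rule summable_comparison_test')
    show "summable (\<lambda>n. C * G n)"
      using \<open>summable G\<close> by (rule summable_mult)
    show "norm (F n * G n) \<le> C * G n" for n
      using mult_right_mono[OF C nonneg] by (simp add: abs_mult nonneg)
  qed
qed

lemma forward_integrable_mult_nonneg:
  assumes "forward_integrable s f u v" and "forward_integrable s g u v" and "\<And>t. 0 \<le> g t"
  shows "forward_integrable s (\<lambda>t. f t * g t) u v"
  using assms by (simp add: forward_integrable_def summable_mult_nonneg)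

lemma symmetric_integral_same:
  assumes "symmetric_integrable \<alpha> \<beta> h u v"
  shows "symmetric_integrable \<alpha> \<beta> h u u" and "symmetric_integral \<alpha> \<beta> h u u = 0"
  using assms
  by (simp_all add: symmetric_integrable_eq_forward symmetric_integral_eq_forward
      forward_integrable_def forward_integral_def)

text \<open>
  The tails at \<open>w\<close> cancel whatever their value, so the identity is purely algebraic.
\<close>

lemma symmetric_integral_combine:
  "symmetric_integral \<alpha> \<beta> h u w + symmetric_integral \<alpha> \<beta> h w v = symmetric_integral \<alpha> \<beta> h u v"
  by (simp add: symmetric_integral_eq_forward forward_integral_def right_diff_distrib)

lemma symmetric_integrable_swap:
  "symmetric_integrable \<alpha> \<beta> h u v \<longleftrightarrow> symmetric_integrable \<alpha> \<beta> h v u"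
  by (auto simp: symmetric_integrable_eq_forward forward_integrable_def)

lemma symmetric_integral_swap:
  "symmetric_integral \<alpha> \<beta> h u v = - symmetric_integral \<alpha> \<beta> h v u"
  by (simp add: symmetric_integral_eq_forward forward_integral_def right_diff_distrib)

lemma symmetric_integral_cmult:
  assumes "symmetric_integrable \<alpha> \<beta> h u v"
  shows "symmetric_integrable \<alpha> \<beta> (\<lambda>t. k * h t) u v"
    and "symmetric_integral \<alpha> \<beta> (\<lambda>t. k * h t) u v = k * symmetric_integral \<alpha> \<beta> h u v"
proof -
  note int = assms[unfolded symmetric_integrable_eq_forward]
  show "symmetric_integrable \<alpha> \<beta> (\<lambda>t. k * h t) u v"
    using int by (simp add: symmetric_integrable_eq_forward forward_integrable_def summable_mult)
  show "symmetric_integral \<alpha> \<beta> (\<lambda>t. k * h t) u v = k * symmetric_integral \<alpha> \<beta> h u v"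
    unfolding symmetric_integral_eq_forward
      forward_integral_cmult[OF conjunct1[OF int]] forward_integral_cmult[OF conjunct2[OF int]]
    by (simp add: distrib_left mult.left_commute)
qed

lemma symmetric_integral_add:
  assumes "symmetric_integrable \<alpha> \<beta> f u v" and "symmetric_integrable \<alpha> \<beta> g u v"
  shows "symmetric_integrable \<alpha> \<beta> (\<lambda>t. f t + g t) u v"
    and "symmetric_integral \<alpha> \<beta> (\<lambda>t. f t + g t) u v =
      symmetric_integral \<alpha> \<beta> f u v + symmetric_integral \<alpha> \<beta> g u v"
proof -
  note int = assms[unfolded symmetric_integrable_eq_forward]
  show "symmetric_integrable \<alpha> \<beta> (\<lambda>t. f t + g t) u v"
    using int by (simp add: symmetric_integrable_eq_forward forward_integrable_def summable_add)
  show "symmetric_integral \<alpha> \<beta> (\<lambda>t. f t + g t) u v =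
      symmetric_integral \<alpha> \<beta> f u v + symmetric_integral \<alpha> \<beta> g u v"
    unfolding symmetric_integral_eq_forward
      forward_integral_add[OF conjunct1[OF int(1)] conjunct1[OF int(2)]]
      forward_integral_add[OF conjunct2[OF int(1)] conjunct2[OF int(2)]]
    by (simp add: distrib_left)
qed

lemma symmetric_integrable_mult_nonneg:
  assumes "symmetric_integrable \<alpha> \<beta> f u v" and "symmetric_integrable \<alpha> \<beta> g u v"
    and "\<And>t. 0 \<le> g t"
  shows "symmetric_integrable \<alpha> \<beta> (\<lambda>t. f t * g t) u v"
  using assms by (simp add: symmetric_integrable_eq_forward forward_integrable_mult_nonneg)

theorem theorem6:
  fixes \<alpha> \<beta> a b c k :: real and f g :: "real \<Rightarrow> real"
  assumes "\<alpha> \<ge> 0" and "\<beta> \<ge> 0" and "\<alpha> + \<beta> > 0" and "a < b"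
    and "symmetric_integrable \<alpha> \<beta> f a b"
    and "symmetric_integrable \<alpha> \<beta> g a b"
    and "c \<in> {a..b}"
  shows "(symmetric_integrable \<alpha> \<beta> f a a \<and> symmetric_integral \<alpha> \<beta> f a a = 0) \<and>
    (symmetric_integrable \<alpha> \<beta> f a c \<longrightarrow> symmetric_integrable \<alpha> \<beta> f c b \<longrightarrow>
      symmetric_integral \<alpha> \<beta> f a b =
        symmetric_integral \<alpha> \<beta> f a c + symmetric_integral \<alpha> \<beta> f c b) \<and>
    (symmetric_integrable \<alpha> \<beta> f b a \<and>
      symmetric_integral \<alpha> \<beta> f a b = - symmetric_integral \<alpha> \<beta> f b a) \<and>
    (symmetric_integrable \<alpha> \<beta> (\<lambda>t. k * f t) a b \<and>
      symmetric_integral \<alpha> \<beta> (\<lambda>t. k * f t) a b = k * symmetric_integral \<alpha> \<beta> f a b) \<and>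
    (symmetric_integrable \<alpha> \<beta> (\<lambda>t. f t + g t) a b \<and>
      symmetric_integral \<alpha> \<beta> (\<lambda>t. f t + g t) a b =
        symmetric_integral \<alpha> \<beta> f a b + symmetric_integral \<alpha> \<beta> g a b) \<and>
    ((\<forall>t. g t \<ge> 0) \<longrightarrow> symmetric_integrable \<alpha> \<beta> (\<lambda>t. f t * g t) a b)"
  using symmetric_integral_same[OF assms(5)]
    symmetric_integral_combine[of \<alpha> \<beta> f a c b, symmetric]
    assms(5)[unfolded symmetric_integrable_swap[of \<alpha> \<beta> f a b]]
    symmetric_integral_swap[of \<alpha> \<beta> f a b]
    symmetric_integral_cmult[OF assms(5)]
    symmetric_integral_add[OF assms(5,6)]
    symmetric_integrable_mult_nonneg[OF assms(5,6)]
  by blast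

end
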